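(* Let $\{\pi_k(t)\}_{k=0}^{\infty}$ be the monic Legendre polynomials, i.e. the monic polynomials with $\deg\pi_k=k$ that are mutually orthogonal with respect to $\langle f,g\rangle=\int_{-1}^{1}f(t)g(t)\,dt$. Then they satisfy the three-term recurrence relation \[ \pi_{k+1}(t)=t\,\pi_k(t)-\frac{k^2}{4k^2-1}\,\pi_{k-1}(t),\qquad k=1,2,\ldots, \] with initial conditions $\pi_0(t)=1$ and $\pi_1(t)=t$.
   Context: A polynomial of degree $k$ is monic if its coefficient of $t^k$ equals $1$. *)

theory Defs
  imports "HOL-Analysis.Analysis" "HOL-Computational_Algebra.Polynomial"
begin

definition legendre_inner :: "real poly \<Rightarrow> real poly \<Rightarrow> real" where
  "legendre_inner f g = integral {-1..1} (\<lambda>t. poly f t * poly g t)"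

definition monic_legendre :: "(nat \<Rightarrow> real poly) \<Rightarrow> bool" where
  "monic_legendre \<pi> \<longleftrightarrow>
     (\<forall>k. degree (\<pi> k) = k \<and> lead_coeff (\<pi> k) = 1) \<and>
     (\<forall>i j. i \<noteq> j \<longrightarrow> legendre_inner (\<pi> i) (\<pi> j) = 0)"

end

theory Submission
  imports Defs
begin

text \<open>
  A polynomial of degree below \<open>k\<close> that is orthogonal to all polynomials of degree below \<open>k\<close> is zero;
  hence \<open>\<pi>\<^sub>k\<close> is unique, so it has the parity of \<open>k\<close>, and
  \<open>\<pi>\<^sub>k\<^sub>+\<^sub>1 = t \<pi>\<^sub>k - (h\<^sub>k / h\<^sub>k\<^sub>-\<^sub>1) \<pi>\<^sub>k\<^sub>-\<^sub>1\<close> with \<open>h\<^sub>k = \<langle>\<pi>\<^sub>k, \<pi>\<^sub>k\<rangle>\<close>.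
  Integrating \<open>(t \<pi>\<^sub>k\<^sup>2)'\<close> and \<open>(\<pi>\<^sub>k \<pi>\<^sub>k\<^sub>-\<^sub>1)'\<close> over \<open>[-1, 1]\<close> gives
  \<open>(2 k + 1) h\<^sub>k = 2 \<pi>\<^sub>k(1)\<^sup>2\<close> and \<open>k h\<^sub>k\<^sub>-\<^sub>1 = 2 \<pi>\<^sub>k(1) \<pi>\<^sub>k\<^sub>-\<^sub>1(1)\<close>, and eliminating the boundary
  values yields \<open>h\<^sub>k / h\<^sub>k\<^sub>-\<^sub>1 = k\<^sup>2 / (4 k\<^sup>2 - 1)\<close>.
\<close>

section \<open>Properties of the inner product on [-1, 1]\<close>

lemma poly_integrable_on: "(\<lambda>t. poly f t * poly g t) integrable_on {a..b::real}"
  by (intro integrable_continuous_interval continuous_intros)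

lemma legendre_inner_commute: "legendre_inner f g = legendre_inner g f"
  by (simp add: legendre_inner_def mult.commute)

lemma legendre_inner_add_right:
  "legendre_inner f (g + h) = legendre_inner f g + legendre_inner f h"
  by (simp add: legendre_inner_def distrib_left integral_add poly_integrable_on)

lemma legendre_inner_smult_right: "legendre_inner f (smult c g) = c * legendre_inner f g"
  by (simp add: legendre_inner_def mult.left_commute[of _ c])

lemma legendre_inner_diff_right:
  "legendre_inner f (g - h) = legendre_inner f g - legendre_inner f h"
  using legendre_inner_add_right[of f g "smult (-1) h"]
  by (simp only: legendre_inner_smult_right) simp

lemma legendre_inner_zero_right: "legendre_inner f 0 = 0"
  by (simp add: legendre_inner_def)

lemma legendre_inner_mult_left: "legendre_inner (f * g) h = legendre_inner f (g * h)"
  by (simp add: legendre_inner_def mult.assoc)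

text \<open>The substitution t -> -t maps [-1, 1] onto itself.\<close>

lemma legendre_inner_reflect:
  "legendre_inner (pcompose f [:0, -1:]) (pcompose g [:0, -1:]) = legendre_inner f g"
  using Henstock_Kurzweil_Integration.integral_reflect_real[of 1 "-1" "\<lambda>t. poly f t * poly g t"]
  by (simp add: legendre_inner_def poly_pcompose)

text \<open>A continuous nonnegative function with zero integral vanishes, so \<open>f\<close> would
  have infinitely many roots.\<close>

lemma legendre_inner_self_eq_0:
  assumes "legendre_inner f f = 0"
  shows "f = 0"
proof (rule ccontr)
  assume "f \<noteq> 0"
  then have "finite {x. poly f x = 0}"
    by (rule poly_roots_finite)
  moreover have "\<forall>x\<in>{-1..1}. poly f x * poly f x = 0"
    using assms unfolding legendre_inner_def
    by (subst (asm) integral_eq_0_iff) (simp_all add: continuous_intros)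
  then have "{-1..1} \<subseteq> {x. poly f x = 0}"
    by auto
  ultimately have "finite {-1..1::real}"
    by (rule finite_subset[rotated])
  then show False
    by (simp add: infinite_Icc)
qed

text \<open>Integration by parts: the fundamental theorem of calculus applied to
  \<open>f * g\<close>.\<close>

lemma legendre_inner_pderiv:
  "legendre_inner (pderiv f) g + legendre_inner f (pderiv g)
     = poly f 1 * poly g 1 - poly f (-1) * poly g (-1)"
proof -
  have "((\<lambda>t. poly (pderiv (f * g)) t) has_integral poly (f * g) 1 - poly (f * g) (-1)) {-1..1}"
    by (rule fundamental_theorem_of_calculus)
       (auto simp del: poly_mult simp flip: has_real_derivative_iff_has_vector_derivative
             intro!: DERIV_subset[OF poly_DERIV])
  then have "integral {-1..1} (\<lambda>t. poly (pderiv f) t * poly g t + poly f t * poly (pderiv g) t)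
      = poly f 1 * poly g 1 - poly f (-1) * poly g (-1)"
    by (intro integral_unique) (simp add: pderiv_mult algebra_simps)
  then show ?thesis
    by (simp add: legendre_inner_def integral_add poly_integrable_on)
qed

section \<open>Orthogonality to lower degrees, and parity\<close>

context
  fixes \<pi> :: "nat \<Rightarrow> real poly"
  assumes monic_legendre: "monic_legendre \<pi>"
begin

lemma degree_legendre: "degree (\<pi> k) = k"
  and coeff_legendre_self: "coeff (\<pi> k) k = 1"
  and orthogonal_legendre: "i \<noteq> j \<Longrightarrow> legendre_inner (\<pi> i) (\<pi> j) = 0"
  using monic_legendre unfolding monic_legendre_def by metis+

lemma coeff_legendre_eq_0: "k < i \<Longrightarrow> coeff (\<pi> k) i = 0"
  by (simp add: coeff_eq_0 degree_legendre)

lemma legendre_inner_lower_degree: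
  assumes "\<And>i. m \<le> i \<Longrightarrow> coeff f i = 0" and "m \<le> n"
  shows "legendre_inner (\<pi> n) f = 0"
  using assms
proof (induction m arbitrary: f)
  case 0
  then have "f = 0"
    by (simp add: poly_eq_iff)
  then show ?case
    by (simp add: legendre_inner_zero_right)
next
  case (Suc m)
  \<comment> \<open>Removing the top term by a multiple of \<open>\<pi> m\<close> lowers the degree
    bound; since m < n, this does not change the inner product.\<close>
  have "legendre_inner (\<pi> n) (f - smult (coeff f m) (\<pi> m)) = 0"
  proof (rule Suc.IH)
    fix i
    assume "m \<le> i"
    then show "coeff (f - smult (coeff f m) (\<pi> m)) i = 0"
      using Suc.prems(1)[of i]
      by (cases "i = m") (auto simp: coeff_legendre_self coeff_legendre_eq_0)
  qed (use Suc.prems in simp)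
  then show ?case
    using orthogonal_legendre[of n m] Suc.prems
    by (simp add: legendre_inner_diff_right legendre_inner_smult_right)
qed

text \<open>Subtracting the right multiple of \<open>\<pi> n\<close> leaves degree below n, so only
  the coefficient of t^n counts.\<close>

lemma legendre_inner_le_degree:
  assumes "\<And>i. n < i \<Longrightarrow> coeff f i = 0"
  shows "legendre_inner (\<pi> n) f = coeff f n * legendre_inner (\<pi> n) (\<pi> n)"
proof -
  have "legendre_inner (\<pi> n) (f - smult (coeff f n) (\<pi> n)) = 0"
  proof (rule legendre_inner_lower_degree[OF _ order.refl])
    fix i
    assume "n \<le> i"
    then show "coeff (f - smult (coeff f n) (\<pi> n)) i = 0"
      using assms[of i] by (cases "i = n") (auto simp: coeff_legendre_self coeff_legendre_eq_0)
  qed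
  then show ?thesis
    by (simp add: legendre_inner_diff_right legendre_inner_smult_right)
qed

lemma pcompose_legendre: "pcompose (\<pi> n) [:0, -1:] = smult ((-1) ^ n) (\<pi> n)"
proof -
  let ?r = "\<lambda>p. pcompose p [:0, -1 :: real:]"
  \<comment> \<open>The leading terms cancel, so \<open>d\<close> has only terms below degree n. It
    is orthogonal to both of its summands, hence to itself.\<close>
  define d where "d = ?r (\<pi> n) - smult ((-1) ^ n) (\<pi> n)"
  have d: "coeff d i = 0" if "n \<le> i" for i
    using that unfolding d_def
    by (cases "i = n") (auto simp: coeff_pcompose_linear coeff_legendre_self coeff_legendre_eq_0)
  have "?r (?r d) = d"
    by (simp add: pcompose_assoc[symmetric] pcompose_pCons)
  then have "legendre_inner (?r (\<pi> n)) d = legendre_inner (\<pi> n) (?r d)"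
    using legendre_inner_reflect[of "\<pi> n" "?r d"] by simp
  also have "\<dots> = 0"
    by (rule legendre_inner_lower_degree[OF _ order.refl]) (simp add: coeff_pcompose_linear d)
  finally have "legendre_inner d (?r (\<pi> n)) = 0"
    by (simp add: legendre_inner_commute)
  moreover have "legendre_inner d (\<pi> n) = 0"
    using legendre_inner_lower_degree[OF d order.refl] by (simp add: legendre_inner_commute)
  ultimately have "legendre_inner d (?r (\<pi> n) - smult ((-1) ^ n) (\<pi> n)) = 0"
    by (simp add: legendre_inner_diff_right legendre_inner_smult_right)
  then have "d = 0"
    unfolding d_def[symmetric] by (rule legendre_inner_self_eq_0)
  then show ?thesis
    by (simp add: d_def)
qed

lemma poly_legendre_minus: "poly (\<pi> n) (- x) = (-1) ^ n * poly (\<pi> n) x"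
proof -
  have "poly (\<pi> n) (- x) = poly (pcompose (\<pi> n) [:0, -1:]) x"
    by (simp add: poly_pcompose)
  also have "\<dots> = (-1) ^ n * poly (\<pi> n) x"
    by (simp only: pcompose_legendre poly_smult)
  finally show ?thesis .
qed

text \<open>By parity, this coefficient equals its own negative.\<close>

lemma coeff_legendre_Suc: "coeff (\<pi> (Suc n)) n = 0"
proof -
  have "coeff (pcompose (\<pi> (Suc n)) [:0, -1:]) n = (-1) ^ Suc n * coeff (\<pi> (Suc n)) n"
    by (simp only: pcompose_legendre coeff_smult)
  then show ?thesis
    by (simp add: coeff_pcompose_linear)
qed

lemma legendre_inner_self_nonzero: "legendre_inner (\<pi> n) (\<pi> n) \<noteq> 0"
proof
  assume "legendre_inner (\<pi> n) (\<pi> n) = 0"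
  then have "\<pi> n = 0"
    by (rule legendre_inner_self_eq_0)
  then show False
    using coeff_legendre_self[of n] by simp
qed

section \<open>The recurrence with a quotient of squared norms\<close>

lemma legendre_three_term:
  fixes n :: nat
  defines "b \<equiv> legendre_inner (\<pi> (Suc n)) (\<pi> (Suc n)) / legendre_inner (\<pi> n) (\<pi> n)"
  shows "\<pi> (Suc (Suc n)) = [:0, 1:] * \<pi> (Suc n) - smult b (\<pi> n)"
proof -
  define f where "f = \<pi> (Suc (Suc n)) - [:0, 1:] * \<pi> (Suc n) + smult b (\<pi> n)"
  \<comment> \<open>Monicity cancels degree n + 2, and parity removes degree n + 1.\<close>
  have f: "coeff f i = 0" if i: "n < i" for i
  proof -
    consider "i = Suc n" | "i = Suc (Suc n)" | "Suc (Suc n) < i"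
      using i by (metis Suc_lessI)
    then show ?thesis
      by cases (auto simp: f_def coeff_pCons coeff_legendre_self coeff_legendre_eq_0
                 coeff_legendre_Suc split: nat.split)
  qed
  have 1: "legendre_inner f (\<pi> (Suc (Suc n))) = 0"
    using legendre_inner_lower_degree[of "Suc n" f "Suc (Suc n)"] f
    by (simp add: legendre_inner_commute Suc_le_eq)
  \<comment> \<open>Multiplication by t is self-adjoint and shifts the coefficient of t^n in
    \<open>f\<close> to t^(n+1).\<close>
  have "legendre_inner f ([:0, 1:] * \<pi> (Suc n)) = legendre_inner (\<pi> (Suc n)) ([:0, 1:] * f)"
    by (metis legendre_inner_commute legendre_inner_mult_left mult.commute)
  also have "\<dots> = coeff f n * legendre_inner (\<pi> (Suc n)) (\<pi> (Suc n))"
    using f by (subst legendre_inner_le_degree) (auto simp: coeff_pCons split: nat.split)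
  finally have 2: "legendre_inner f ([:0, 1:] * \<pi> (Suc n)) = \<dots>" .
  have 3: "legendre_inner f (\<pi> n) = coeff f n * legendre_inner (\<pi> n) (\<pi> n)"
    using legendre_inner_le_degree[OF f] by (simp add: legendre_inner_commute)
  \<comment> \<open>The choice of \<open>b\<close> makes the contributions of 2 and 3
    cancel.\<close>
  have "legendre_inner f (\<pi> (Suc (Suc n)) - [:0, 1:] * \<pi> (Suc n) + smult b (\<pi> n)) = 0"
    unfolding legendre_inner_add_right legendre_inner_diff_right legendre_inner_smult_right 1 2 3
    using legendre_inner_self_nonzero[of n] by (simp add: b_def)
  then have "f = 0"
    by (intro legendre_inner_self_eq_0) (simp add: f_def)
  then show ?thesis
    by (simp add: f_def algebra_simps)
qed

section \<open>Squared norms through boundary values\<close>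

lemma legendre_norm: "(2 * real n + 1) * legendre_inner (\<pi> n) (\<pi> n) = 2 * (poly (\<pi> n) 1)\<^sup>2"
proof -
  let ?h = "legendre_inner (\<pi> n) (\<pi> n)"
  \<comment> \<open>Applying t d/dt to t^n multiplies it by n.\<close>
  have "legendre_inner (\<pi> n) ([:0, 1:] * pderiv (\<pi> n)) = real n * ?h"
    by (subst legendre_inner_le_degree)
       (auto simp: coeff_pCons coeff_pderiv coeff_legendre_self coeff_legendre_eq_0 split: nat.split)
  moreover have "pderiv ([:0, 1:] * \<pi> n) = \<pi> n + [:0, 1:] * pderiv (\<pi> n)"
    by (simp add: pderiv_pCons)
  moreover have "legendre_inner (pderiv (\<pi> n)) ([:0, 1:] * \<pi> n)
      = legendre_inner (\<pi> n) ([:0, 1:] * pderiv (\<pi> n))"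
    by (metis legendre_inner_commute legendre_inner_mult_left mult.commute)
  ultimately have "2 * real n * ?h + ?h
      = poly (\<pi> n) 1 * poly (\<pi> n) 1 + poly (\<pi> n) (-1) * poly (\<pi> n) (-1)"
    using legendre_inner_pderiv[of "\<pi> n" "[:0, 1:] * \<pi> n"]
    by (simp only: legendre_inner_add_right) simp
  then show ?thesis
    by (cases "even n") (simp_all add: poly_legendre_minus power2_eq_square algebra_simps)
qed

lemma legendre_norm_Suc:
  "real (Suc n) * legendre_inner (\<pi> n) (\<pi> n) = 2 * poly (\<pi> (Suc n)) 1 * poly (\<pi> n) 1"
proof -
  have "legendre_inner (\<pi> n) (pderiv (\<pi> (Suc n))) = real (Suc n) * legendre_inner (\<pi> n) (\<pi> n)"
    by (subst legendre_inner_le_degree)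
       (auto simp: coeff_pderiv coeff_legendre_self coeff_legendre_eq_0)
  moreover have "legendre_inner (\<pi> (Suc n)) (pderiv (\<pi> n)) = 0"
    by (rule legendre_inner_lower_degree[of n])
       (auto simp: coeff_pderiv coeff_legendre_eq_0)
  \<comment> \<open>The product of consecutive polynomials is odd, so the two boundary terms add
    up.\<close>
  ultimately show ?thesis
    using legendre_inner_pderiv[of "\<pi> n" "\<pi> (Suc n)"]
    by (cases "even n")
       (simp_all add: poly_legendre_minus legendre_inner_commute[of "pderiv (\<pi> n)"])
qed

lemma legendre_norm_ratio:
  "legendre_inner (\<pi> (Suc n)) (\<pi> (Suc n)) / legendre_inner (\<pi> n) (\<pi> n)
     = (real (Suc n))\<^sup>2 / (4 * (real (Suc n))\<^sup>2 - 1)"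
proof -
  define m e e' h h' where "m = real (Suc n)" and "e = poly (\<pi> n) 1" and "e' = poly (\<pi> (Suc n)) 1"
    and "h = legendre_inner (\<pi> n) (\<pi> n)" and "h' = legendre_inner (\<pi> (Suc n)) (\<pi> (Suc n))"
  have m: "m \<ge> 1" and h: "h \<noteq> 0"
    using legendre_inner_self_nonzero by (simp_all add: m_def h_def)
  have 1: "(2 * m - 1) * h = 2 * e\<^sup>2" and 2: "(2 * m + 1) * h' = 2 * e'\<^sup>2" and 3: "m * h = 2 * e' * e"
    using legendre_norm[of n] legendre_norm[of "Suc n"] legendre_norm_Suc[of n]
    by (simp_all add: m_def h_def h'_def e_def e'_def algebra_simps)
  \<comment> \<open>The product of 1 and 2 contains the square of the right side of 3, so both
    boundary values drop out.\<close>
  have "h * ((4 * m\<^sup>2 - 1) * h') = ((2 * m - 1) * h) * ((2 * m + 1) * h')"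
    by (simp add: algebra_simps power2_eq_square)
  also have "\<dots> = (2 * e' * e)\<^sup>2"
    by (simp add: 1 2 power_mult_distrib)
  also have "\<dots> = h * (m\<^sup>2 * h)"
    by (simp add: power2_eq_square flip: 3)
  finally have "(4 * m\<^sup>2 - 1) * h' = m\<^sup>2 * h"
    using h by simp
  moreover have "4 * m\<^sup>2 - 1 > 0"
    using m one_le_power[of m 2] by linarith
  ultimately have "h' / h = m\<^sup>2 / (4 * m\<^sup>2 - 1)"
    using h by (simp add: field_simps)
  then show ?thesis
    by (simp add: m_def h_def h'_def)
qed

lemma legendre_0: "\<pi> 0 = 1"
proof (rule poly_eqI)
  fix i
  show "coeff (\<pi> 0) i = coeff 1 i"
    by (cases "i = 0") (simp_all add: coeff_legendre_self coeff_legendre_eq_0)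
qed

lemma legendre_1: "\<pi> (Suc 0) = [:0, 1:]"
proof (rule poly_eqI)
  fix i
  consider "i = 0" | "i = Suc 0" | "Suc 0 < i"
    by (metis Suc_lessI neq0_conv)
  then show "coeff (\<pi> (Suc 0)) i = coeff [:0, 1:] i"
    by cases (auto simp: coeff_legendre_Suc coeff_legendre_self coeff_legendre_eq_0 coeff_pCons
        split: nat.split)
qed

end

theorem corollary2p9:
  fixes \<pi> :: "nat \<Rightarrow> real poly"
  assumes "monic_legendre \<pi>"
  shows "(\<forall>k\<ge>1. \<forall>t. poly (\<pi> (k + 1)) t =
            t * poly (\<pi> k) t - (real k)\<^sup>2 / (4 * (real k)\<^sup>2 - 1) * poly (\<pi> (k - 1)) t)
         \<and> (\<forall>t. poly (\<pi> 0) t = 1)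
         \<and> (\<forall>t. poly (\<pi> 1) t = t)"
proof (intro conjI allI impI)
  fix k t
  assume "1 \<le> (k::nat)"
  then obtain n where k: "k = Suc n"
    by (cases k) auto
  show "poly (\<pi> (k + 1)) t =
      t * poly (\<pi> k) t - (real k)\<^sup>2 / (4 * (real k)\<^sup>2 - 1) * poly (\<pi> (k - 1)) t"
    using legendre_three_term[OF assms, of n] unfolding legendre_norm_ratio[OF assms] k
    by simp
qed (simp_all add: legendre_0[OF assms] legendre_1[OF assms])

end
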